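(* Let $m,n\ge 1$ be integers and let $\bm{A}\in\mathbb{R}^{m\times n}$ be a matrix whose sorted singular values satisfy $\lambda_1>\lambda_2\ge\lambda_3\ge\cdots\ge\lambda_m\ge 0$. Let $f\left(\bm{u}\right)=\min_{\bm{w}\in\mathbb{R}^{n}}\left\Vert \bm{A}-\bm{u}\bm{w}^{T}\right\Vert _{F}^{2}$ for $\bm{u}\in\mathcal{U}_{m,1}$. Suppose the starting point $\bm{u}_0$ is drawn from the uniform distribution on $\mathcal{U}_{m,1}$. Then, with probability one, the gradient descent procedure with infinitesimal steps for $\min_{\bm{u}\in\mathcal{U}_{m,1}} f(\bm{u})$ started at $\bm{u}_0$ finds a global minimizer of $f$; that is, the gradient descent path $\bm{u}(t)$ with $\bm{u}(0)=\bm{u}_0$ converges, as $t\to\infty$, to a point $\bm{u}^*\in\mathcal{U}_{m,1}$ with $f(\bm{u}^* )=\min_{\bm{u}\in\mathcal{U}_{m,1}}f(\bm{u})$.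
   Context: $\mathcal{U}_{m,1}=\{\bm{u}\in\mathbb{R}^m:\ \bm{u}^T\bm{u}=1\}$ is the unit sphere of $\mathbb{R}^m$, and $\Vert\cdot\Vert_F$ is the Frobenius norm. The singular values $\lambda_1,\dots,\lambda_m$ of $\bm{A}$ are the nonnegative square roots of the $m$ eigenvalues of $\bm{A}\bm{A}^T$ counted with multiplicity, in non-increasing order; if $m=1$ the condition $\lambda_1>\lambda_2$ is vacuous. The uniform distribution on $\mathcal{U}_{m,1}$ is the rotation-invariant probability measure. Gradient descent with infinitesimal steps: from a given starting point one takes steps of size $\epsilon>0$ along the negative gradient direction of $f$ on $\mathcal{U}_{m,1}$ until $f$ stops decreasing, and lets $\epsilon\to 0$. The resulting path is the gradient flow on the sphere, $\dot{\bm{u}}(t)=-\nabla f(\bm{u}(t))$, $t\ge 0$, $\bm{u}(0)=\bm{u}_0$. The minimizing $\bm{w}$ in the definition of $f(\bm{u})$ is $\bm{w}_{\bm{u}}=\bm{A}^T\bm{u}$, and $\nabla f(\bm{u})=-2(\bm{A}-\bm{u}\bm{w}_{\bm{u}}^T)\bm{w}_{\bm{u}}=-2(\bm{A}\bm{A}^T\bm{u}-(\bm{u}^T\bm{A}\bm{A}^T\bm{u})\,\bm{u})$, which is tangent to the sphere at $\bm{u}$. *)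

theory Defs
  imports
    "HOL-Analysis.Analysis"
    "HOL-Computational_Algebra.Polynomial"
    "HOL-Probability.Probability_Measure"
begin

definition charpoly :: "'a::comm_ring_1 ^'m^'m \<Rightarrow> 'a poly"
  where "charpoly M = det (mat [:0, 1:] - map_matrix (\<lambda>c. [:c:]) M)"

text \<open>The entries are in non-increasing order and indexed from 0, so that the largest
  singular value is entry 0. For a matrix with \<^term>\<open>m\<close> rows the list has length \<^term>\<open>m\<close>,
  because all roots of the characteristic polynomial of a real symmetric matrix are real.\<close>

definition singular_values :: "real^'n^'m \<Rightarrow> real list"
  where "singular_values A =
    rev (sorted_list_of_multiset (image_mset sqrt (proots (charpoly (A ** transpose A)))))"

text \<open>On the type of matrices, \<^const>\<open>norm\<close> is the Frobenius norm:\<close>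

lemma norm_eq_Frobenius: "norm (B :: real^'n^'m) = sqrt (\<Sum>i\<in>UNIV. \<Sum>j\<in>UNIV. (B $ i $ j)\<^sup>2)"
  by (simp add: norm_eq_sqrt_inner inner_vec_def power2_eq_square)

definition outer_prod :: "real^'m \<Rightarrow> real^'n \<Rightarrow> real^'n^'m"
  where "outer_prod u w = (columnvector u :: real^1^'m) ** rowvector w"

definition rank1_cost :: "real^'n^'m \<Rightarrow> real^'m \<Rightarrow> real"
  where "rank1_cost A u =
    (INF w::real^'n. (norm (A - outer_prod u w))\<^sup>2)"

text \<open>On the unit sphere the infimum is a minimum, attained at \<^term>\<open>transpose A *v u\<close>:\<close>

lemma norm_diff_outer:
  fixes A :: "real^'n^'m"
  assumes "u \<in> sphere 0 1"
  shows "(norm (A - outer_prod u w))\<^sup>2 =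
    (norm A)\<^sup>2 - (norm (transpose A *v u))\<^sup>2 + (norm (w - transpose A *v u))\<^sup>2"
proof -
  let ?O = "outer_prod u w :: real^'n^'m"
  have O: "?O $ i $ j = u $ i * w $ j" for i j
    by (simp add: outer_prod_def matrix_matrix_mult_def columnvector_def rowvector_def)
  have "A \<bullet> ?O = (\<Sum>i\<in>UNIV. \<Sum>j\<in>UNIV. A $ i $ j * (u $ i * w $ j))"
    by (simp add: inner_vec_def O)
  also have "\<dots> = (\<Sum>j\<in>UNIV. \<Sum>i\<in>UNIV. A $ i $ j * (u $ i * w $ j))"
    by (rule sum.swap)
  also have "\<dots> = (transpose A *v u) \<bullet> w"
    by (simp add: inner_vec_def matrix_vector_mult_def transpose_def sum_distrib_right mult.assoc)
  finally have 1: "A \<bullet> ?O = (transpose A *v u) \<bullet> w" .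
  have "?O \<bullet> ?O = (\<Sum>i\<in>UNIV. \<Sum>j\<in>UNIV. (u $ i * u $ i) * (w $ j * w $ j))"
    by (simp add: inner_vec_def O mult_ac)
  also have "\<dots> = (u \<bullet> u) * (w \<bullet> w)"
    by (simp add: inner_vec_def sum_product)
  also have "u \<bullet> u = 1"
    using assms by (simp add: dot_square_norm)
  finally have 2: "?O \<bullet> ?O = w \<bullet> w" by simp
  show ?thesis
    using 1 2 by (simp add: power2_norm_eq_inner inner_diff inner_commute)
qed

lemma rank1_cost_attained:
  fixes A :: "real^'n^'m"
  assumes "u \<in> sphere 0 1"
  shows "is_arg_min (\<lambda>w. (norm (A - outer_prod u w))\<^sup>2) (\<lambda>_. True) (transpose A *v u)"
    and "rank1_cost A u = (norm (A - outer_prod u (transpose A *v u)))\<^sup>2"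
proof -
  show *: "is_arg_min (\<lambda>w. (norm (A - outer_prod u w))\<^sup>2) (\<lambda>_. True) (transpose A *v u)"
    by (simp add: is_arg_min_def norm_diff_outer[OF assms])
  show "rank1_cost A u = (norm (A - outer_prod u (transpose A *v u)))\<^sup>2"
    unfolding rank1_cost_def
    by (rule cInf_eq_minimum) (use * in \<open>auto simp: is_arg_min_def not_less\<close>)
qed

text \<open>The Riemannian gradient: the tangent vector at \<^term>\<open>x\<close> that represents the derivative of
  \<^term>\<open>f\<close> along the sphere. The derivative within the sphere alone would leave the
  normal component of \<^term>\<open>g\<close> undetermined.\<close>

definition has_sphere_gradient :: "('a::euclidean_space \<Rightarrow> real) \<Rightarrow> 'a \<Rightarrow> 'a \<Rightarrow> bool"
  where "has_sphere_gradient f x g \<longleftrightarrow>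
    x \<in> sphere 0 1 \<and> g \<bullet> x = 0 \<and> (f has_derivative (\<lambda>h. g \<bullet> h)) (at x within sphere 0 1)"

lemma has_sphere_gradient_unique:
  assumes "has_sphere_gradient f x g" "has_sphere_gradient f x g'"
  shows "g = g'"
proof -
  define d where "d = g - g'"
  have x: "norm x = 1" and dx: "d \<bullet> x = 0" "x \<bullet> d = 0"
    using assms by (auto simp: has_sphere_gradient_def d_def inner_diff inner_commute)
  have "((\<lambda>y. f y - f y) has_derivative (\<lambda>h. g \<bullet> h - g' \<bullet> h)) (at x within sphere 0 1)"
    using assms unfolding has_sphere_gradient_def by (blast intro: has_derivative_diff)
  then have D: "((\<lambda>y. 0::real) has_derivative (\<lambda>h. d \<bullet> h)) (at x within sphere 0 1)"
    by (simp add: d_def inner_diff_left)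
  show ?thesis
  proof (cases "d = 0")
    case False
    define e where "e = d /\<^sub>R norm d"
    define c where "c = (\<lambda>t::real. cos t *\<^sub>R x + sin t *\<^sub>R e)"
    have e: "e \<bullet> e = 1" "e \<bullet> x = 0" "x \<bullet> e = 0" "x \<bullet> x = 1"
      using False x dx by (simp_all add: e_def dot_square_norm power2_eq_square)
    have "c t \<bullet> c t = 1" for t
      using sin_cos_squared_add3[of t] by (simp add: c_def inner_add e)
    then have sub: "c ` UNIV \<subseteq> sphere 0 1"
      by (auto simp: norm_eq_1)
    have C: "(c has_derivative (\<lambda>t. t *\<^sub>R e)) (at 0)"
      unfolding c_def by (auto intro!: derivative_eq_intros)
    have D': "((\<lambda>y. 0::real) has_derivative (\<lambda>h. d \<bullet> h)) (at (c 0) within c ` UNIV)"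
      using has_derivative_subset[OF D sub] by (simp add: c_def)
    have "((\<lambda>t. 0::real) has_derivative (\<lambda>t. d \<bullet> (t *\<^sub>R e))) (at 0)"
      using diff_chain_within[OF C D'] by (simp add: o_def)
    from has_derivative_unique[OF this has_derivative_const]
    have "d \<bullet> e = 0"
      by (metis scaleR_one)
    then show ?thesis
      using False by (simp add: e_def)
  qed (simp add: d_def)
qed

lemma has_sphere_gradient_rank1_cost:
  fixes A :: "real^'n^'m"
  assumes u: "u \<in> sphere 0 1"
  shows "has_sphere_gradient (rank1_cost A) u
    (- 2 *\<^sub>R (A ** transpose A *v u - (u \<bullet> (A ** transpose A *v u)) *\<^sub>R u))"
proof -
  let ?M = "A ** transpose A"
  define r where "r = u \<bullet> (?M *v u)"
  define F where "F = (\<lambda>x. (norm A)\<^sup>2 - (transpose A *v x) \<bullet> (transpose A *v x) + r * (x \<bullet> x - 1))"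
  have uu: "u \<bullet> u = 1"
    using u by (simp add: dot_square_norm)
  have adj: "(transpose A *v x) \<bullet> (transpose A *v y) = (?M *v x) \<bullet> y" for x y
    by (metis dot_lmul_matrix inner_commute transpose_matrix_vector matrix_vector_mul_assoc)
  have adj2: "(?M *v h) \<bullet> u = (?M *v u) \<bullet> h" for h
    by (metis adj inner_commute)
  have L: "((\<lambda>x. transpose A *v x) has_derivative (\<lambda>h. transpose A *v h)) (at u within S)" for S
    by (intro bounded_linear_imp_has_derivative matrix_vector_mul_bounded_linear)
  have D: "(F has_derivative (\<lambda>h. 0 -
      ((transpose A *v u) \<bullet> (transpose A *v h) + (transpose A *v h) \<bullet> (transpose A *v u)) +
      r * (u \<bullet> h + h \<bullet> u - 0))) (at u within sphere 0 1)"
    unfolding F_def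
    by (intro has_derivative_add has_derivative_diff has_derivative_const has_derivative_inner
        has_derivative_mult_right has_derivative_ident L)
  have D_eq: "0 - ((transpose A *v u) \<bullet> (transpose A *v h) + (transpose A *v h) \<bullet> (transpose A *v u)) +
      r * (u \<bullet> h + h \<bullet> u - 0) = (- 2 *\<^sub>R (?M *v u - r *\<^sub>R u)) \<bullet> h" for h
    unfolding adj adj2 inner_scaleR_left inner_diff_left
    by (simp add: algebra_simps inner_commute[of h u])
  have DF: "(F has_derivative (\<lambda>h. (- 2 *\<^sub>R (?M *v u - r *\<^sub>R u)) \<bullet> h))
      (at u within sphere 0 1)"
    by (rule has_derivative_eq_rhs[OF D]) (rule ext, rule D_eq)
  have F: "rank1_cost A x = F x" if "x \<in> sphere 0 1" for x
  proof -
    have "rank1_cost A x = (norm A)\<^sup>2 - (norm (transpose A *v x))\<^sup>2"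
      unfolding rank1_cost_attained(2)[OF that] norm_diff_outer[OF that] by simp
    moreover have "x \<bullet> x = 1"
      using that by (simp add: dot_square_norm)
    ultimately show ?thesis
      by (simp add: F_def power2_norm_eq_inner)
  qed
  have "(rank1_cost A has_derivative (\<lambda>h. (- 2 *\<^sub>R (?M *v u - r *\<^sub>R u)) \<bullet> h))
      (at u within sphere 0 1)"
    by (rule has_derivative_transform[OF u F DF])
  moreover have "(- 2 *\<^sub>R (?M *v u - r *\<^sub>R u)) \<bullet> u = 0"
    by (simp add: inner_diff_left uu r_def inner_commute[of "?M *v u"])
  ultimately show ?thesis
    using u unfolding has_sphere_gradient_def r_def by blast
qed

definition sphere_gradient_flow :: "('a::euclidean_space \<Rightarrow> real) \<Rightarrow> 'a \<Rightarrow> (real \<Rightarrow> 'a) \<Rightarrow> bool"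
  where "sphere_gradient_flow f u0 u \<longleftrightarrow>
    u 0 = u0 \<and>
    (\<forall>t\<ge>0. u t \<in> sphere 0 1 \<and>
      (\<exists>g. has_sphere_gradient f (u t) g \<and> (u has_vector_derivative - g) (at t within {0..})))"

text \<open>Invariance is under the full orthogonal group. This determines the measure in every
  dimension, including the sphere \<open>{-1, 1}\<close> of dimension 0, on which \<open>SO(1)\<close>
  is not transitive.\<close>

definition uniform_on_sphere :: "'a::euclidean_space measure \<Rightarrow> bool"
  where "uniform_on_sphere U \<longleftrightarrow>
    prob_space U \<and> sets U = sets (restrict_space borel (sphere 0 1)) \<and>
    (\<forall>T. orthogonal_transformation T \<longrightarrow> distr U U T = U)"

lemma uniform_on_sphere_exists: "\<exists>U :: (real, 'm::{finite,wellorder}) vec measure. uniform_on_sphere U"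
proof -
  define B where "B = ball (0::(real, 'm) vec) 1"
  define S where "S = sphere (0::(real, 'm) vec) 1"
  define M where "M = uniform_measure lborel B"
  define a where "a = (axis undefined 1 :: (real, 'm) vec)"
  define N where "N = (\<lambda>x::(real, 'm) vec. if x = 0 then a else x /\<^sub>R norm x)"
  define R where "R = restrict_space borel S"
  define U where "U = distr M R N"
  have B0: "emeasure lborel B \<noteq> 0" "emeasure lborel B \<noteq> \<infinity>"
    using content_ball_pos[of 1 "0::(real, 'm) vec"] emeasure_lborel_ball_finite[of "0::(real, 'm) vec" 1]
    by (auto simp: B_def measure_def)
  interpret M: prob_space M
    unfolding M_def using B0 by (intro prob_space_uniform_measure)
  have sM: "sets M = sets borel" by (simp add: M_def)
  have NS: "N x \<in> S" for x
    by (simp add: N_def S_def a_def)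
  have "N \<in> borel_measurable borel"
    unfolding N_def by measurable
  then have N: "N \<in> measurable M R"
    unfolding R_def using NS sM
    by (intro measurable_restrict_space2) (auto cong: measurable_cong_sets)
  have inv: "distr M borel T = M" if T: "orthogonal_transformation T" for T
  proof (rule measure_eqI)
    fix C assume "C \<in> sets (distr M borel T)"
    then have C: "C \<in> sets borel" by simp
    have Tm: "T \<in> borel_measurable borel"
      using T by (intro borel_measurable_continuous_onI linear_continuous_on
          linear_conv_bounded_linear[THEN iffD1] orthogonal_transformation_linear)
    then have TC: "T -` C \<in> sets borel"
      using C by (metis inf_top_right measurable_sets space_borel)
    have TB: "T ` B = B"
      unfolding B_def image_orthogonal_transformation_ball[OF T]
      by (simp only: linear_0[OF orthogonal_transformation_linear[OF T]])
    have "T ` (B \<inter> T -` C) = T ` B \<inter> C"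
      by blast
    then have im: "T ` (B \<inter> T -` C) = B \<inter> C"
      unfolding TB .
    have lm: "B \<inter> X \<in> lmeasurable" if "X \<in> sets borel" for X
      unfolding B_def by (rule fmeasurable_Int_fmeasurable) (use that in simp_all)
    have "measure lebesgue (B \<inter> C) = measure lebesgue (B \<inter> T -` C)"
      using measure_orthogonal_image[OF T lm[OF TC]] unfolding im .
    then have "emeasure lebesgue (B \<inter> C) = emeasure lebesgue (B \<inter> T -` C)"
      using emeasure_eq_measure2[OF lm[OF TC]] emeasure_eq_measure2[OF lm[OF C]] by (simp only:)
    then have "emeasure lborel (B \<inter> C) = emeasure lborel (B \<inter> T -` C)"
      using C TC by (simp add: B_def)
    then have "emeasure M (T -` C) = emeasure M C"
      using C TC by (simp add: M_def B_def)
    then show "emeasure (distr M borel T) C = emeasure M C"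
      using C Tm sM by (subst emeasure_distr) (auto simp: M_def cong: measurable_cong_sets)
  qed (simp add: sM)
  have "distr U U T = U" if T: "orthogonal_transformation T" for T
  proof -
    have Tm: "T \<in> borel_measurable borel"
      using T by (intro borel_measurable_continuous_onI linear_continuous_on
          linear_conv_bounded_linear[THEN iffD1] orthogonal_transformation_linear)
    have TR: "T \<in> measurable R R"
      unfolding R_def using Tm orthogonal_transformation_norm[OF T]
      by (intro measurable_restrict_space2 measurable_restrict_space1)
         (auto simp: S_def space_restrict_space)
    have TM: "T \<in> measurable M borel"
      using Tm sM by (auto cong: measurable_cong_sets)
    have NB: "N \<in> measurable borel R"
      using N sM by (auto cong: measurable_cong_sets)
    have "distr U U T = distr U R T"
      by (rule distr_cong) (auto simp: U_def)
    also have "\<dots> = distr M R (T \<circ> N)"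
      unfolding U_def by (rule distr_distr[OF TR N])
    also have "\<dots> = distr M R (N \<circ> T)"
    proof (rule distr_cong_AE)
      have "AE x in lborel. x \<noteq> (0::(real, 'm) vec)"
        by (rule AE_lborel_singleton)
      then have "AE x in M. x \<noteq> 0"
        unfolding M_def by (intro AE_uniform_measureI) (auto simp: B_def)
      then show "AE x in M. (T \<circ> N) x = (N \<circ> T) x"
      proof eventually_elim
        case (elim x)
        then show ?case
          using orthogonal_transformation_norm[OF T, of x]
            linear_cmul[OF orthogonal_transformation_linear[OF T], of _ x]
          by (auto simp: N_def)
      qed
      show "T \<circ> N \<in> measurable M R" "N \<circ> T \<in> measurable M R"
        using measurable_comp[OF N TR] measurable_comp[OF TM NB] by auto
    qed auto
    also have "\<dots> = distr (distr M borel T) R N"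
      by (rule distr_distr[OF NB TM, symmetric])
    also have "\<dots> = U"
      by (simp add: inv[OF T] U_def)
    finally show ?thesis .
  qed
  moreover have "prob_space U"
    unfolding U_def by (rule M.prob_space_distr[OF N])
  moreover have "sets U = sets (restrict_space borel (sphere 0 1))"
    by (simp add: U_def R_def S_def)
  ultimately show ?thesis
    unfolding uniform_on_sphere_def by blast
qed

end

theory Submission
  imports Defs
begin

text \<open>In an orthonormal eigenbasis of \<open>M = A A\<^sup>T\<close> the coordinates of the gradient flow satisfy
  \<open>c\<^sub>i' = 2 (d\<^sub>i - r) c\<^sub>i\<close> with a common factor \<open>r = u \<bullet> M u \<ge> 0\<close>. Hence the ratios \<open>c\<^sub>i / c\<^sub>k\<close> evolve as
  \<open>exp (2 (d\<^sub>i - d\<^sub>k) t)\<close>, and if \<open>d\<^sub>k\<close> is strictly dominant and \<open>c\<^sub>k(0) \<noteq> 0\<close>, the flow converges to the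
  dominant eigenvector with the sign of \<open>c\<^sub>k(0)\<close>. The initial points with \<open>c\<^sub>k(0) = 0\<close> form a great
  subsphere, which is a null set.\<close>

section \<open>Orthonormal eigenbases\<close>

text \<open>A maximizer of x \<bullet> f x on the compact unit sphere of \<open>S\<close> is an
  eigenvector by first-order variation; invariance of \<open>S\<close> keeps the variation inside
  \<open>S\<close>. The subspace is arbitrary so that \<open>S\<close> can be the orthogonal
  complement of eigenvectors already found.\<close>

lemma selfadjoint_eigenvector_in_subspace:
  fixes f :: "'a::euclidean_space \<Rightarrow> 'a"
  assumes f: "linear f" and sym: "\<And>x y. f x \<bullet> y = x \<bullet> f y"
    and S: "subspace S" "S \<noteq> {0}" and inv: "\<And>x. x \<in> S \<Longrightarrow> f x \<in> S"
  obtains x c where "x \<in> S" "norm x = 1" "f x = c *\<^sub>R x"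
proof -
  let ?K = "S \<inter> sphere 0 1"
  obtain z where z: "z \<in> S" "z \<noteq> 0"
    using S subspace_0 by blast
  then have "z /\<^sub>R norm z \<in> ?K"
    using S by (auto intro: subspace_scale)
  then have "?K \<noteq> {}"
    by blast
  moreover have "compact ?K"
    by (rule closed_Int_compact[OF closed_subspace[OF S(1)] compact_sphere])
  moreover have "continuous_on ?K (\<lambda>x. x \<bullet> f x)"
    by (intro continuous_intros linear_continuous_on linear_conv_bounded_linear[THEN iffD1] f)
  ultimately obtain x where x: "x \<in> ?K" and max: "\<And>y. y \<in> ?K \<Longrightarrow> y \<bullet> f y \<le> x \<bullet> f x"
    using continuous_attains_sup by metis
  define c where "c = x \<bullet> f x"
  \<comment> \<open>Homogeneous form of maximality: \<open>g\<close> is a quadratic form that is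
    nonnegative on \<open>S\<close> and vanishes at the maximizer \<open>x\<close>.\<close>
  define g where "g = (\<lambda>y. c * (y \<bullet> y) - y \<bullet> f y)"
  have xx: "x \<bullet> x = 1"
    using x by (simp add: dot_square_norm)
  have g_nonneg: "0 \<le> g y" if "y \<in> S" for y
  proof (cases "y = 0")
    case False
    have "y /\<^sub>R norm y \<in> ?K"
      using False that S by (auto intro: subspace_scale)
    then have "(y /\<^sub>R norm y) \<bullet> f (y /\<^sub>R norm y) \<le> c"
      unfolding c_def by (rule max)
    then have "(y \<bullet> f y) / (norm y)\<^sup>2 \<le> c"
      by (simp add: linear_cmul[OF f] power2_eq_square divide_inverse mult_ac)
    then show ?thesis
      using False by (simp add: g_def divide_simps dot_square_norm)
  qed (simp add: g_def)
  \<comment> \<open>The eigenvector residual, which also serves as the direction of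
    variation.\<close>
  define h where "h = c *\<^sub>R x - f x"
  have h: "h \<in> S"
    using x inv S by (auto simp: h_def intro: subspace_diff subspace_scale)
  \<comment> \<open>Expand \<open>g\<close> at \<open>x - s *\<^sub>R h\<close>: the constant term
    is g x = 0 and the linear coefficient is -2 (h \<bullet> h).\<close>
  have key: "0 \<le> s\<^sup>2 * g h - 2 * s * (h \<bullet> h)" for s
  proof -
    have "x - s *\<^sub>R h \<in> S"
      using x h S by (auto intro: subspace_diff subspace_scale)
    then have "0 \<le> g (x - s *\<^sub>R h)"
      by (rule g_nonneg)
    also have "g (x - s *\<^sub>R h) = s\<^sup>2 * g h - 2 * s * (c * (x \<bullet> h) - f x \<bullet> h)"
      using sym[of x h] xx c_def
      by (simp add: g_def linear_diff[OF f] linear_cmul[OF f] power2_eq_square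
          inner_commute[of h x] inner_commute[of h "f x"] algebra_simps)
    also have "c * (x \<bullet> h) - f x \<bullet> h = h \<bullet> h"
      by (simp add: h_def inner_diff_left)
    finally show ?thesis .
  qed
  have gh: "0 \<le> g h"
    by (rule g_nonneg[OF h])
  have "h \<bullet> h \<le> 0"
  proof (rule ccontr)
    assume "\<not> h \<bullet> h \<le> 0"
    then have pos: "0 < h \<bullet> h" by linarith
    \<comment> \<open>Small enough for the linear term to beat the quadratic one; the added 1 covers
      the case g h = 0.\<close>
    define s where "s = (h \<bullet> h) / (g h + 1)"
    have s: "0 < s" "s * g h < h \<bullet> h"
      using pos gh by (auto simp: s_def field_simps)
    have "s * (s * g h) < s * (2 * (h \<bullet> h))"
      using s pos by (intro mult_strict_left_mono) linarith+
    with key[of s] show False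
      by (simp add: power2_eq_square mult_ac)
  qed
  then have "h = 0"
    by (metis inner_gt_zero_iff not_le)
  then have "f x = c *\<^sub>R x"
    by (simp add: h_def)
  with that x show ?thesis
    by auto
qed

text \<open>Induction on the number of eigenvectors: the orthogonal complement of those already
  found is invariant because f is self-adjoint, and it is nonzero while their number is below the
  dimension.\<close>

lemma selfadjoint_orthonormal_eigenvectors:
  fixes f :: "'a::euclidean_space \<Rightarrow> 'a"
  assumes f: "linear f" and sym: "\<And>x y. f x \<bullet> y = x \<bullet> f y"
    and "k \<le> DIM('a)"
  shows "\<exists>B. finite B \<and> card B = k \<and> pairwise orthogonal B \<and>
    (\<forall>b\<in>B. norm b = 1 \<and> (\<exists>c. f b = c *\<^sub>R b))"
  using assms(3)
proof (induction k)
  case 0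
  show ?case by (rule exI[of _ "{}"]) simp
next
  case (Suc k)
  then obtain B where B: "finite B" "card B = k" "pairwise orthogonal B"
      "\<And>b. b \<in> B \<Longrightarrow> norm b = 1 \<and> (\<exists>c. f b = c *\<^sub>R b)"
    by auto
  define S where "S = {y. \<forall>b\<in>B. orthogonal b y}"
  have "dim B < DIM('a)"
    using dim_le_card[of B B] B Suc.prems by (auto simp: span_superset)
  then obtain w where "w \<noteq> 0" "\<And>y. y \<in> span B \<Longrightarrow> orthogonal w y"
    by (rule orthogonal_to_subspace_exists) blast
  then have "w \<in> S" "S \<noteq> {0}"
    by (auto simp: S_def orthogonal_commute span_base)
  moreover have "f y \<in> S" if "y \<in> S" for y
    using that B(4) by (force simp: S_def orthogonal_def sym[symmetric])
  moreover have "subspace S"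
    unfolding S_def by (rule subspace_orthogonal_to_vectors)
  ultimately obtain x c where x: "x \<in> S" "norm x = 1" "f x = c *\<^sub>R x"
    using selfadjoint_eigenvector_in_subspace[OF f sym, of S] by blast
  have "x \<notin> B"
    using x by (auto simp: S_def orthogonal_self)
  with B x show ?case
    by (intro exI[of _ "insert x B"])
      (auto simp: S_def pairwise_insert orthogonal_commute)
qed

text \<open>The index type of \<open>e\<close> is that of the coordinates, so orthonormality already
  makes \<open>e\<close> a basis; this is proved in \<open>expansion\<close>.\<close>

locale orthonormal_eigenbasis =
  fixes M :: "real^'m^'m" and e :: "'m \<Rightarrow> real^'m" and d :: "'m \<Rightarrow> real"
  assumes orthonormal: "e i \<bullet> e j = (if i = j then 1 else 0)"
    and eigen: "M *v e i = d i *\<^sub>R e i"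

lemma symmetric_orthonormal_eigenbasis:
  fixes M :: "real^'m^'m"
  assumes "transpose M = M"
  obtains e d where "orthonormal_eigenbasis M e d"
proof -
  have sym: "(M *v x) \<bullet> y = x \<bullet> (M *v y)" for x y
    by (metis assms dot_lmul_matrix transpose_matrix_vector)
  obtain B where B: "finite B" "card B = CARD('m)" "pairwise orthogonal B"
      and eig: "\<forall>b\<in>B. norm b = 1 \<and> (\<exists>c. M *v b = c *\<^sub>R b)"
    using selfadjoint_orthonormal_eigenvectors[of "(*v) M", OF _ sym order_refl] by auto
  obtain e where e: "bij_betw e (UNIV :: 'm set) B"
    using B finite_same_card_bij[of "UNIV :: 'm set" B] by auto
  then have eB: "e i \<in> B" and einj: "e i = e j \<longleftrightarrow> i = j" for i j
    by (auto simp: bij_betw_def inj_eq)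
  from eig eB have "\<forall>i. \<exists>c. M *v e i = c *\<^sub>R e i"
    by blast
  from choice[OF this] obtain d where "\<And>i. M *v e i = d i *\<^sub>R e i"
    by blast
  moreover have "e i \<bullet> e j = (if i = j then 1 else 0)" for i j
    using B(3) eig eB[of i] eB[of j] einj[of i j]
    by (auto simp: pairwise_def orthogonal_def dot_square_norm)
  ultimately show ?thesis
    by (intro that orthonormal_eigenbasis.intro)
qed

context orthonormal_eigenbasis
begin

lemma expansion: "(\<Sum>i\<in>UNIV. (x \<bullet> e i) *\<^sub>R e i) = x"
proof -
  have inj: "inj e"
    by (rule injI) (metis orthonormal zero_neq_one)
  have orth: "pairwise orthogonal (range e)" and norm: "\<And>b. b \<in> range e \<Longrightarrow> norm b = 1"
    by (auto simp: pairwise_def orthogonal_def orthonormal norm_eq_1)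
  moreover have "0 \<notin> range e"
    using norm norm_zero zero_neq_one by metis
  ultimately have "independent (range e)"
    by (intro pairwise_orthogonal_independent)
  moreover have "card (range e) = DIM(real^'m)"
    by (simp add: card_image inj)
  ultimately have "span (range e) = UNIV"
    by (metis card_eq_dim dim_UNIV finite finite_imageI subset_UNIV top.extremum_uniqueI)
  with orthonormal_basis_expand[OF orth norm, of x] show ?thesis
    by (simp add: sum.reindex[OF inj])
qed

lemma inner_expansion: "x \<bullet> y = (\<Sum>i\<in>UNIV. (x \<bullet> e i) * (y \<bullet> e i))"
proof -
  have "x \<bullet> y = (\<Sum>i\<in>UNIV. (x \<bullet> e i) *\<^sub>R e i) \<bullet> y"
    by (simp only: expansion)
  also have "\<dots> = (\<Sum>i\<in>UNIV. (x \<bullet> e i) * (y \<bullet> e i))"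
    by (simp add: inner_sum_left inner_commute[of y])
  finally show ?thesis .
qed

lemma eq_iff_coordinates: "x = y \<longleftrightarrow> (\<forall>i. x \<bullet> e i = y \<bullet> e i)"
  by (metis (no_types, lifting) expansion sum.cong)

lemma coordinate_sum: "(\<Sum>j\<in>UNIV. a j *\<^sub>R e j) \<bullet> e i = a i"
  by (simp add: inner_sum_left orthonormal if_distrib cong: if_cong)

lemma matrix_coordinate: "(M *v x) \<bullet> e i = d i * (x \<bullet> e i)"
proof -
  have "M *v x = M *v (\<Sum>j\<in>UNIV. (x \<bullet> e j) *\<^sub>R e j)"
    by (simp only: expansion)
  also have "\<dots> = (\<Sum>j\<in>UNIV. (x \<bullet> e j * d j) *\<^sub>R e j)"
    by (simp add: linear_sum linear_cmul[OF matrix_vector_mul_linear] eigen)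
  finally show ?thesis
    by (simp add: coordinate_sum)
qed

text \<open>Diagonalization carried out over the polynomial ring: (X - M) Q = Q (X - D) for the
  matrix \<open>Q\<close> of eigenvectors, and det Q cancels. This identifies the roots in
  \<open>singular_values\<close>, with multiplicity, with the family \<open>d\<close>.\<close>

lemma charpoly_eq: "charpoly M = (\<Prod>i\<in>UNIV. [:- d i, 1:])"
proof -
  let ?C = "\<lambda>B :: real^'m^'m. map_matrix (\<lambda>c. [:c:]) B"
  define Q where "Q = (\<chi> i j. e j $ i)"
  define D where "D = (\<chi> i j. if i = j then d i else 0)"
  have const_sum: "[:\<Sum>i\<in>I. g i:] = (\<Sum>i\<in>I. [:g i:])" for I :: "'m set" and g :: "'m \<Rightarrow> real"
    by (rule sum_comp_morphism[of "\<lambda>c. [:c:]", unfolded o_def, symmetric]) auto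
  \<comment> \<open>Embedding real matrices as matrices of constant polynomials is multiplicative,
    which transports M Q = Q D and the orthogonality of \<open>Q\<close>.\<close>
  have hom: "?C (X ** Y) = ?C X ** ?C Y" for X Y
    by (simp add: vec_eq_iff matrix_matrix_mult_def const_sum mult.commute)
  have one: "?C (mat 1) = mat 1"
    by (simp add: vec_eq_iff mat_def one_pCons)
  have QtQ: "transpose Q ** Q = mat 1"
    using orthonormal
    by (simp add: Q_def vec_eq_iff matrix_matrix_mult_def transpose_def mat_def inner_vec_def)
  have MQ: "M ** Q = Q ** D"
  proof -
    have "(M ** Q) $ i $ j = (Q ** D) $ i $ j" for i j
    proof -
      have "(M ** Q) $ i $ j = (M *v e j) $ i"
        by (simp add: Q_def matrix_matrix_mult_def matrix_vector_mult_def)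
      also have "\<dots> = (Q ** D) $ i $ j"
        by (simp add: eigen Q_def D_def matrix_matrix_mult_def if_distrib cong: if_cong)
      finally show ?thesis .
    qed
    then show ?thesis by (simp add: vec_eq_iff)
  qed
  let ?X = "mat [:0, 1:] :: real poly^'m^'m"
  have X_comm: "?X ** Y = Y ** ?X" for Y
    by (simp add: vec_eq_iff matrix_matrix_mult_def mat_def if_distrib if_distribR mult.commute
        cong: if_cong)
  have diff_mult: "(X - Y) ** Z = X ** Z - Y ** Z" and mult_diff: "Z ** (X - Y) = Z ** X - Z ** Y"
    for X Y Z :: "real poly^'m^'m"
    by (simp_all add: vec_eq_iff matrix_matrix_mult_def left_diff_distrib right_diff_distrib
        sum_subtractf)
  have "det (?X - ?C M) * det (?C Q) = det ((?X - ?C M) ** ?C Q)"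
    by (simp add: det_mul)
  also have "(?X - ?C M) ** ?C Q = ?C Q ** (?X - ?C D)"
    by (simp add: diff_mult mult_diff X_comm hom[symmetric] MQ)
  also have "det \<dots> = det (?X - ?C D) * det (?C Q)"
    by (simp add: det_mul mult.commute)
  finally have "det (?X - ?C M) * det (?C Q) = det (?X - ?C D) * det (?C Q)" .
  \<comment> \<open>A factor of 1 is nonzero, and real polynomials form an integral domain, so det Q
    may be cancelled.\<close>
  moreover have "det (?C (transpose Q)) * det (?C Q) = 1"
    by (simp add: det_mul[symmetric] hom[symmetric] QtQ one)
  then have "det (?C Q) \<noteq> 0"
    by auto
  ultimately have "charpoly M = det (?X - ?C D)"
    by (simp add: charpoly_def)
  also have "\<dots> = (\<Prod>i\<in>UNIV. [:- d i, 1:])"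
    by (subst det_diagonal) (auto simp: mat_def D_def)
  finally show ?thesis .
qed

end

section \<open>The spectral gap in terms of eigenvalues\<close>

text \<open>If two indices shared the largest eigenvalue, its square root would occur twice in the
  list of singular values and fill its first two entries, against the gap.\<close>

lemma strict_dominant_eigenvalue:
  fixes A :: "real^'n^'m"
  assumes "orthonormal_eigenbasis (A ** transpose A) e d"
    and gap: "CARD('m) \<ge> 2 \<longrightarrow> singular_values A ! 0 > singular_values A ! 1"
  obtains k where "\<And>j. j \<noteq> k \<Longrightarrow> d j < d k"
proof -
  interpret orthonormal_eigenbasis "A ** transpose A" e d by fact
  define N where "N = image_mset (\<lambda>i. sqrt (d i)) (mset_set UNIV)"
  define ys where "ys = singular_values A"
  have "proots (charpoly (A ** transpose A)) = image_mset d (mset_set UNIV)"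
    unfolding charpoly_eq by (subst proots_prod) (auto simp: sum_unfold_sum_mset)
  then have ys: "ys = rev (sorted_list_of_multiset N)"
    by (simp add: ys_def N_def singular_values_def image_mset.compositionality comp_def)
  have mset: "mset ys = N" and sorted: "sorted (rev ys)"
    by (simp_all add: ys)
  have len: "length ys = CARD('m)"
    using mset by (metis N_def size_image_mset size_mset size_mset_set)
  obtain k where k: "\<And>j. d j \<le> d k"
    using obtains_MAX[of "UNIV :: 'm set" d] by (metis Max_ge UNIV_I UNIV_not_empty finite finite_imageI imageI)
  have "d j < d k" if "j \<noteq> k" for j
  proof (rule ccontr)
    assume "\<not> d j < d k"
    with k[of j] have eq: "d j = d k" by simp
    \<comment> \<open>Two distinct indices force at least two rows, so the gap assumption applies;
      with one row there is no competing \<open>j\<close>.\<close>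
    have "card {j, k} \<le> CARD('m)"
      by (intro card_mono) auto
    with \<open>j \<noteq> k\<close> have "2 \<le> CARD('m)" by simp
    with gap have lt: "ys ! 1 < ys ! 0" and len2: "2 \<le> length ys"
      by (simp_all add: ys_def len[unfolded ys_def])
    then obtain y0 y1 zs where ys': "ys = y0 # y1 # zs"
      by (cases ys; cases "tl ys") auto
    let ?s = "sqrt (d k)"
    have "N = {#?s, ?s#} + image_mset (\<lambda>i. sqrt (d i)) (mset_set (UNIV - {j, k}))"
    proof -
      have "mset_set (UNIV :: 'm set) = mset_set ({j, k} \<union> (UNIV - {j, k}))"
        by (rule arg_cong[of _ _ mset_set]) auto
      also have "\<dots> = mset_set {j, k} + mset_set (UNIV - {j, k})"
        by (rule mset_set_Union) auto
      finally show ?thesis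
        using \<open>j \<noteq> k\<close> eq by (simp add: N_def)
    qed
    then have two: "2 \<le> count (mset ys) ?s"
      by (simp add: mset)
    have "y \<le> ?s" if "y \<in> set ys" for y
    proof -
      have "y \<in># N" using that by (metis mset set_mset_mset)
      then show ?thesis using k by (auto simp: N_def)
    qed
    then have "y0 \<le> ?s"
      by (simp add: ys')
    moreover have "z \<le> y1" if "z \<in> set zs" for z
      using sorted that by (auto simp: ys' sorted_append)
    \<comment> \<open>Sortedness and the gap put every entry after \<open>y0\<close> strictly below
      \<open>y0\<close>, hence below \<open>?s\<close>; only \<open>y0\<close> can equal
      \<open>?s\<close>.\<close>
    ultimately have "y1 \<noteq> ?s" "?s \<notin> set zs"
      using lt by (force simp: ys')+
    then have "count (mset ys) ?s \<le> 1"
      by (simp add: ys' not_in_iff[THEN iffD1])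
    with two show False by simp
  qed
  with that show ?thesis .
qed

section \<open>Orthogonality is a null event\<close>

lemma space_uniform_on_sphere:
  fixes U :: "'a::euclidean_space measure"
  assumes "uniform_on_sphere U"
  shows "space U = sphere 0 1"
proof -
  have "sets U = sets (restrict_space borel (sphere 0 1))"
    using assms by (simp add: uniform_on_sphere_def)
  from sets_eq_imp_space_eq[OF this] show ?thesis
    by (simp add: space_restrict_space)
qed

text \<open>By Fubini the set of \<open>y\<close> for which the hyperplane \<open>y\<^sup>\<bottom>\<close> has positive measure is Lebesgue null.
  Rotation invariance transfers this from one good \<open>y\<close> to every direction.\<close>

lemma uniform_on_sphere_AE_not_orthogonal:
  fixes U :: "(real^'m) measure"
  assumes U: "uniform_on_sphere U" and "a \<noteq> 0"
  shows "AE x in U. x \<bullet> a \<noteq> 0"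
proof -
  interpret U: prob_space U
    using U by (simp add: uniform_on_sphere_def)
  interpret pair_sigma_finite U lborel ..
  have sets_U: "sets U = sets (restrict_space borel (sphere 0 1))"
    using U by (simp add: uniform_on_sphere_def)
  have space_U: "space U = sphere 0 1"
    by (rule space_uniform_on_sphere[OF U])
  have id_meas [measurable]: "(\<lambda>x. x) \<in> borel_measurable U"
    by (subst measurable_cong_sets[OF sets_U refl]) (intro measurable_restrict_space1, simp)
  \<comment> \<open>The easy side of Fubini: for a fixed nonzero \<open>x\<close> the hyperplane
    orthogonal to it is null.\<close>
  have "AE y in lborel. x \<bullet> y \<noteq> 0" if "x \<in> space U" for x
  proof -
    have "x \<noteq> 0"
      using that by (auto simp: space_U)
    then have "{y. x \<bullet> y = 0} \<in> null_sets lebesgue"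
      by (simp add: negligible_hyperplane flip: negligible_iff_null_sets)
    moreover have "{y. x \<bullet> y = 0} \<in> sets lborel"
      by (simp add: borel_closed closed_hyperplane)
    ultimately have "{y. x \<bullet> y = 0} \<in> null_sets lborel"
      by (simp add: null_sets_completion_iff)
    then show ?thesis
      by (rule AE_I') auto
  qed
  then have "AE x in U. AE y in lborel. x \<bullet> y \<noteq> 0"
    by (rule AE_I2)
  also have "?this \<longleftrightarrow> (AE y in lborel. AE x in U. x \<bullet> y \<noteq> 0)"
    by (rule AE_commute) measurable
  finally have "AE y in lborel. y \<noteq> 0 \<and> (AE x in U. x \<bullet> y \<noteq> 0)"
    using AE_lborel_singleton[of "0 :: real^'m"] by eventually_elim blast
  \<comment> \<open>Lebesgue measure is not the zero measure, so a property holding almost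
    everywhere has a witness.\<close>
  moreover have "ae_filter (lborel :: (real^'m) measure) \<noteq> bot"
    by (simp add: ae_filter_eq_bot_iff)
  ultimately obtain y where y: "y \<noteq> 0" "AE x in U. x \<bullet> y \<noteq> 0"
    using eventually_happens' by blast
  \<comment> \<open>The multiple of \<open>a\<close> with the length of \<open>y\<close>: some
    orthogonal map takes \<open>y\<close> to it, and it defines the same hyperplane as
    \<open>a\<close>.\<close>
  define b where "b = (norm y / norm a) *\<^sub>R a"
  have "norm y = norm b"
    using \<open>a \<noteq> 0\<close> by (simp add: b_def)
  then obtain T where T: "orthogonal_transformation T" and Ty: "T y = b"
    by (rule orthogonal_transformation_exists)
  have "T \<in> borel_measurable borel"
    using T by (intro borel_measurable_continuous_onI linear_continuous_on
        linear_conv_bounded_linear[THEN iffD1] orthogonal_transformation_linear)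
  then have TU: "T \<in> measurable U U"
    using orthogonal_transformation_norm[OF T]
    by (subst measurable_cong_sets[OF sets_U sets_U])
      (intro measurable_restrict_space2 measurable_restrict_space1, auto simp: space_restrict_space)
  \<comment> \<open>Here T x \<bullet> b = T x \<bullet> T y = x \<bullet> y.\<close>
  have "AE x in U. T x \<bullet> b \<noteq> 0"
    using y T by (simp add: orthogonal_transformation_def flip: Ty)
  moreover have "{x \<in> space U. x \<bullet> b \<noteq> 0} \<in> sets U"
    by measurable
  ultimately have "AE x in distr U U T. x \<bullet> b \<noteq> 0"
    by (simp add: AE_distr_iff[OF TU])
  moreover have distr_eq: "distr U U T = U"
    using U T by (simp add: uniform_on_sphere_def)
  ultimately have "AE x in U. x \<bullet> b \<noteq> 0"
    unfolding distr_eq by blast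
  then show ?thesis
    by eventually_elim (auto simp: b_def)
qed

section \<open>The gradient flow\<close>

context orthonormal_eigenbasis
begin

text \<open>The nonlinear factor \<open>r\<close> is common to all coordinates and drops out of
  their ratios. The ratio is stated cross-multiplied, since coordinates may vanish, and for an
  arbitrary solution, so that the limit is obtained for every flow.\<close>

lemma flow_coordinates:
  assumes nonneg: "\<And>i. 0 \<le> d i"
    and flow: "\<And>t. 0 \<le> t \<Longrightarrow>
      (u has_vector_derivative 2 *\<^sub>R (M *v u t - (u t \<bullet> (M *v u t)) *\<^sub>R u t)) (at t within {0..})"
    and "0 \<le> t"
  shows "(u t \<bullet> e i) * (u 0 \<bullet> e k) = exp (2 * (d i - d k) * t) * (u t \<bullet> e k) * (u 0 \<bullet> e i)"
proof -
  define r where "r s = u s \<bullet> (M *v u s)" for s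
  have r: "0 \<le> r s" for s
    unfolding r_def
    by (subst inner_expansion)
      (auto simp: matrix_coordinate mult.left_commute[of _ "d _"] nonneg intro!: sum_nonneg)
  \<comment> \<open>The exponential removes the \<open>d j\<close> term, leaving the equation h' =
    -2 r h, the same for every \<open>j\<close>.\<close>
  define h where "h j s = exp (- 2 * d j * s) * (u s \<bullet> e j)" for j s
  have h: "(h j has_real_derivative - 2 * r s * h j s) (at s within {0..})" if "0 \<le> s" for j s
  proof -
    have "((\<lambda>s. u s \<bullet> e j) has_vector_derivative
        (2 *\<^sub>R (M *v u s - r s *\<^sub>R u s)) \<bullet> e j) (at s within {0..})"
      unfolding r_def
      by (rule bounded_linear.has_vector_derivative[OF bounded_linear_inner_left flow[OF that]])
    then have "((\<lambda>s. u s \<bullet> e j) has_real_derivative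
        2 * (d j - r s) * (u s \<bullet> e j)) (at s within {0..})"
      by (simp add: has_real_derivative_iff_has_vector_derivative matrix_coordinate
          algebra_simps)
    then show ?thesis
      unfolding h_def
      by (auto intro!: derivative_eq_intros simp: algebra_simps)
  qed
  \<comment> \<open>A combination of two solutions of that equation with constant coefficients,
    chosen to vanish at time 0.\<close>
  define w where "w s = h i s * h k 0 - h k s * h i 0" for s
  have w: "((\<lambda>s. (w s)\<^sup>2) has_real_derivative - 4 * r s * (w s)\<^sup>2) (at s within {0..})"
    if "0 \<le> s" for s
    unfolding w_def using h[OF that]
    by (auto intro!: derivative_eq_intros simp: algebra_simps power2_eq_square)
  \<comment> \<open>Since r is nonnegative, w squared cannot increase, so it stays at its initial
    value 0.\<close>
  have "(w t)\<^sup>2 \<le> (w 0)\<^sup>2"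
  proof (rule DERIV_nonpos_imp_decreasing_open[OF \<open>0 \<le> t\<close>])
    fix s :: real assume "0 < s"
    then have "at s within {0..} = at s"
      by (intro at_within_interior) simp
    then have "((\<lambda>s. (w s)\<^sup>2) has_real_derivative - 4 * r s * (w s)\<^sup>2) (at s)"
      using w[of s] \<open>0 < s\<close> by simp
    then show "\<exists>y. ((\<lambda>s. (w s)\<^sup>2) has_real_derivative y) (at s) \<and> y \<le> 0"
      using r[of s] by (intro exI conjI) (auto intro: mult_nonneg_nonneg)
  next
    have "continuous_on {0..} (\<lambda>s. (w s)\<^sup>2)"
      using w by (intro DERIV_continuous_on) auto
    then show "continuous_on {0..t} (\<lambda>s. (w s)\<^sup>2)"
      by (rule continuous_on_subset) auto
  qed
  then have "w t = 0"
    by (simp add: w_def)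
  then have "exp (- 2 * d i * t) * (u t \<bullet> e i) * (u 0 \<bullet> e k) =
      exp (- 2 * d k * t) * (u t \<bullet> e k) * (u 0 \<bullet> e i)"
    by (simp add: w_def h_def)
  then have "exp (2 * d i * t) * (exp (- 2 * d i * t) * (u t \<bullet> e i) * (u 0 \<bullet> e k)) =
      exp (2 * d i * t) * (exp (- 2 * d k * t) * (u t \<bullet> e k) * (u 0 \<bullet> e i))"
    by simp
  moreover have "exp (2 * d i * t) * exp (- 2 * d i * t) = 1"
    by (simp flip: exp_add)
  moreover have "exp (2 * d i * t) * exp (- 2 * d k * t) = exp (2 * (d i - d k) * t)"
    unfolding exp_add[symmetric] by (simp add: left_diff_distrib right_diff_distrib)
  ultimately show ?thesis
    by (simp only: mult.assoc[symmetric] mult_1)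
qed

text \<open>Writing each coordinate as \<open>c t * q i t\<close>, the ratios \<open>q i\<close>
  tend to 1 for i = k and to 0 otherwise. The unit norm then determines the absolute value of
  \<open>c\<close>, and continuity determines its sign.\<close>

lemma flow_tendsto_dominant_eigenvector:
  assumes nonneg: "\<And>i. 0 \<le> d i" and dominant: "\<And>j. j \<noteq> k \<Longrightarrow> d j < d k"
    and flow: "\<And>t. 0 \<le> t \<Longrightarrow>
      (u has_vector_derivative 2 *\<^sub>R (M *v u t - (u t \<bullet> (M *v u t)) *\<^sub>R u t)) (at t within {0..})"
    and unit: "\<And>t. 0 \<le> t \<Longrightarrow> norm (u t) = 1"
    and init: "u 0 \<bullet> e k \<noteq> 0"
  shows "(u \<longlongrightarrow> sgn (u 0 \<bullet> e k) *\<^sub>R e k) at_top"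
proof -
  define c where "c t = u t \<bullet> e k" for t
  define q where "q i t = exp (2 * (d i - d k) * t) * ((u 0 \<bullet> e i) / (u 0 \<bullet> e k))" for i t
  have coord: "u t \<bullet> e i = c t * q i t" if "0 \<le> t" for i t
    using flow_coordinates[OF nonneg flow that, of i k] init
    by (simp add: c_def q_def field_simps)
  have q_lim: "(q i \<longlongrightarrow> (if i = k then 1 else 0)) at_top" for i
  proof (cases "i = k")
    case True
    then show ?thesis
      using init by (simp add: q_def[abs_def])
  next
    case False
    then have "2 * (d i - d k) < 0"
      using dominant by simp
    then have "filterlim (\<lambda>t. 2 * (d i - d k) * t) at_bot at_top"
      by (rule filterlim_tendsto_neg_mult_at_bot[OF tendsto_const _ filterlim_ident])
    then have "((\<lambda>t. exp (2 * (d i - d k) * t)) \<longlongrightarrow> 0) at_top"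
      by (rule filterlim_compose[OF exp_at_bot])
    from tendsto_mult[OF this tendsto_const[of "(u 0 \<bullet> e i) / (u 0 \<bullet> e k)"]] show ?thesis
      unfolding q_def using False by simp
  qed
  define S where "S t = (\<Sum>i\<in>UNIV. (q i t)\<^sup>2)" for t
  have S_lim: "(S \<longlongrightarrow> 1) at_top"
  proof -
    have "(S \<longlongrightarrow> (\<Sum>i\<in>UNIV. (if i = k then 1 else 0)\<^sup>2)) at_top"
      unfolding S_def by (intro tendsto_sum tendsto_power q_lim)
    then show ?thesis
      by (simp add: if_distrib[of "\<lambda>x. x\<^sup>2"] cong: if_cong)
  qed
  have cS: "(c t)\<^sup>2 * S t = 1" if "0 \<le> t" for t
  proof -
    have "1 = u t \<bullet> u t"
      using unit[OF that] by (simp add: dot_square_norm)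
    also have "\<dots> = (\<Sum>i\<in>UNIV. (c t * q i t) * (c t * q i t))"
      by (subst inner_expansion) (simp add: coord[OF that])
    finally show ?thesis
      by (simp add: S_def sum_distrib_left power2_eq_square mult_ac)
  qed
  \<comment> \<open>By \<open>cS\<close> the coordinate \<open>c\<close> never vanishes, so the
    intermediate value theorem rules out a change of sign.\<close>
  have sign: "0 < c 0 * c t" if "0 \<le> t" for t
  proof (rule ccontr)
    assume "\<not> 0 < c 0 * c t"
    then have "c 0 * c t \<le> 0" "0 \<le> c 0 * c 0"
      by auto
    moreover have "continuous_on {0..} u"
      using flow by (intro continuous_on_vector_derivative) auto
    then have "continuous_on {0..t} (\<lambda>s. c 0 * c s)"
      unfolding c_def by (intro continuous_intros) (auto intro: continuous_on_subset)
    ultimately obtain s where "0 \<le> s" "c 0 * c s = 0"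
      using IVT2'[of "\<lambda>s. c 0 * c s" t 0 0] \<open>0 \<le> t\<close> by auto
    with cS[of s] init show False
      by (auto simp: c_def)
  qed
  have c_eq: "c t = sgn (c 0) / sqrt (S t)" if "0 \<le> t" for t
  proof -
    have "S t = inverse ((c t)\<^sup>2)"
      using cS[OF that] by (metis inverse_unique)
    then have "sgn (c 0) / sqrt (S t) = sgn (c 0) * \<bar>c t\<bar>"
      by (simp add: real_sqrt_inverse divide_inverse)
    also have "\<dots> = c t"
      using sign[OF that] by (auto simp: zero_less_mult_iff)
    finally show ?thesis ..
  qed
  have "((\<lambda>t. sgn (c 0) / sqrt (S t)) \<longlongrightarrow> sgn (c 0) / sqrt 1) at_top"
    by (intro tendsto_intros S_lim) auto
  then have "((\<lambda>t. sgn (c 0) / sqrt (S t)) \<longlongrightarrow> sgn (c 0)) at_top"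
    by simp
  then have c_lim: "(c \<longlongrightarrow> sgn (c 0)) at_top"
  proof (rule Lim_transform_eventually)
    show "\<forall>\<^sub>F t in at_top. sgn (c 0) / sqrt (S t) = c t"
      using eventually_ge_at_top[of 0] by eventually_elim (rule c_eq[symmetric])
  qed
  have "((\<lambda>t. \<Sum>i\<in>UNIV. (c t * q i t) *\<^sub>R e i) \<longlongrightarrow>
      (\<Sum>i\<in>UNIV. (sgn (c 0) * (if i = k then 1 else 0)) *\<^sub>R e i)) at_top"
    by (intro tendsto_intros c_lim q_lim)
  also have "(\<Sum>i\<in>UNIV. (sgn (c 0) * (if i = k then 1 else 0)) *\<^sub>R e i) = sgn (c 0) *\<^sub>R e k"
    by (simp add: eq_iff_coordinates[of _ "sgn (c 0) *\<^sub>R e k"] coordinate_sum orthonormal)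
  finally show ?thesis
    unfolding c_def[symmetric]
  proof (rule Lim_transform_eventually)
    show "\<forall>\<^sub>F t in at_top. (\<Sum>i\<in>UNIV. (c t * q i t) *\<^sub>R e i) = u t"
      using eventually_ge_at_top[of 0]
      by eventually_elim (simp add: expansion flip: coord)
  qed
qed

text \<open>The flow is the normalization of the linear flow \<open>v' = 2 M v\<close>.\<close>

lemma flow_exists:
  assumes "norm u0 = 1"
  obtains u where "u 0 = u0" "\<And>t. norm (u t) = 1"
    "\<And>t. (u has_vector_derivative 2 *\<^sub>R (M *v u t - (u t \<bullet> (M *v u t)) *\<^sub>R u t)) (at t)"
proof -
  define v where "v t = (\<Sum>i\<in>UNIV. (exp (2 * d i * t) * (u0 \<bullet> e i)) *\<^sub>R e i)" for t
  define u where "u t = inverse (norm (v t)) *\<^sub>R v t" for t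
  have v0: "v 0 = u0"
    by (simp add: v_def expansion)
  have v_coord: "v t \<bullet> e i = exp (2 * d i * t) * (u0 \<bullet> e i)" for t i
    by (simp add: v_def coordinate_sum)
  \<comment> \<open>The linear flow multiplies each coordinate by a positive factor and so cannot
    reach 0; the normalization is therefore defined at all times.\<close>
  have v_ne: "v t \<noteq> 0" for t
  proof
    assume "v t = 0"
    then have "exp (2 * d i * t) * (u0 \<bullet> e i) = 0" for i
      by (simp flip: v_coord)
    then have "u0 = 0"
      by (simp add: eq_iff_coordinates)
    with assms show False by simp
  qed
  have v_deriv: "(v has_vector_derivative 2 *\<^sub>R (M *v v t)) (at t)" for t
  proof -
    have "(v has_vector_derivative
        (\<Sum>i\<in>UNIV. (2 * d i * (exp (2 * d i * t) * (u0 \<bullet> e i))) *\<^sub>R e i)) (at t)"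
      unfolding v_def
      by (intro has_vector_derivative_sum)
        (auto intro!: derivative_eq_intros simp: has_real_derivative_iff_has_vector_derivative[symmetric])
    also have "(\<Sum>i\<in>UNIV. (2 * d i * (exp (2 * d i * t) * (u0 \<bullet> e i))) *\<^sub>R e i) = 2 *\<^sub>R (M *v v t)"
      by (simp add: eq_iff_coordinates[of _ "2 *\<^sub>R (M *v v t)"] coordinate_sum matrix_coordinate v_coord)
    finally show ?thesis .
  qed
  \<comment> \<open>Obtained by differentiating v \<bullet> v and applying the chain rule to its
    power -1/2.\<close>
  have n_deriv: "((\<lambda>t. inverse (norm (v t))) has_real_derivative
      - 2 * (v t \<bullet> (M *v v t)) / norm (v t) ^ 3) (at t)" for t
  proof -
    have "((\<lambda>t. v t \<bullet> v t) has_vector_derivative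
        (v t \<bullet> (2 *\<^sub>R (M *v v t)) + (2 *\<^sub>R (M *v v t)) \<bullet> v t)) (at t)"
      by (rule bounded_bilinear.has_vector_derivative[OF bounded_bilinear_inner v_deriv v_deriv])
    then have "((\<lambda>t. v t \<bullet> v t) has_real_derivative 4 * (v t \<bullet> (M *v v t))) (at t)"
      by (simp add: has_real_derivative_iff_has_vector_derivative inner_commute[of "M *v v t"])
    then show ?thesis
      unfolding norm_eq_sqrt_inner using v_ne[of t]
      by (auto intro!: derivative_eq_intros simp: divide_simps power2_eq_square power3_eq_cube
            inner_ge_zero[THEN leD])
  qed
  show thesis
  proof
    show "u 0 = u0"
      using assms by (simp add: u_def v0)
    show "norm (u t) = 1" for t
      using v_ne[of t] by (simp add: u_def)
    have "(u has_vector_derivative (inverse (norm (v t)) *\<^sub>R (2 *\<^sub>R (M *v v t)) +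
        (- 2 * (v t \<bullet> (M *v v t)) / norm (v t) ^ 3) *\<^sub>R v t)) (at t)" for t
      unfolding u_def by (rule has_vector_derivative_scaleR[OF n_deriv v_deriv])
    moreover have "inverse (norm (v t)) *\<^sub>R (2 *\<^sub>R (M *v v t)) +
        (- 2 * (v t \<bullet> (M *v v t)) / norm (v t) ^ 3) *\<^sub>R v t =
      2 *\<^sub>R (M *v u t - (u t \<bullet> (M *v u t)) *\<^sub>R u t)" for t
      by (simp add: u_def linear_cmul[OF matrix_vector_mul_linear] scaleR_diff_right divide_inverse
          power3_eq_cube mult_ac)
    ultimately show "(u has_vector_derivative
        2 *\<^sub>R (M *v u t - (u t \<bullet> (M *v u t)) *\<^sub>R u t)) (at t)" for t
      by metis
  qed
qed

text \<open>On the unit sphere the quadratic form is an average of the eigenvalues, weighted by the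
  squared coordinates.\<close>

lemma quadratic_form_le_dominant:
  assumes "\<And>j. d j \<le> d k" and "norm x = 1"
  shows "x \<bullet> (M *v x) \<le> d k"
proof -
  have "x \<bullet> (M *v x) = (\<Sum>i\<in>UNIV. d i * (x \<bullet> e i)\<^sup>2)"
    by (subst inner_expansion) (simp add: matrix_coordinate power2_eq_square mult_ac)
  also have "\<dots> \<le> (\<Sum>i\<in>UNIV. d k * (x \<bullet> e i)\<^sup>2)"
    by (intro sum_mono mult_right_mono assms) auto
  also have "\<dots> = d k * (x \<bullet> x)"
    by (subst inner_expansion) (simp add: sum_distrib_left power2_eq_square)
  finally show ?thesis
    using assms(2) by (simp add: dot_square_norm)
qed

end

section \<open>The cost on the sphere and its flow as an explicit equation\<close>

lemma inner_gram_matrix: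
  fixes A :: "real^'n^'m"
  shows "x \<bullet> (A ** transpose A *v x) = (norm (transpose A *v x))\<^sup>2"
  by (metis dot_lmul_matrix matrix_vector_mul_assoc power2_norm_eq_inner
      transpose_matrix_vector)

text \<open>Minimizing the cost thus means maximizing the quadratic form of the Gram matrix.\<close>

lemma rank1_cost_sphere:
  fixes A :: "real^'n^'m"
  assumes "norm x = 1"
  shows "rank1_cost A x = (norm A)\<^sup>2 - x \<bullet> (A ** transpose A *v x)"
proof -
  have x: "x \<in> sphere 0 1"
    using assms by simp
  show ?thesis
    unfolding rank1_cost_attained(2)[OF x] norm_diff_outer[OF x] inner_gram_matrix by simp
qed

text \<open>Uniqueness of the sphere gradient replaces the existentially quantified gradient in the
  flow by its explicit formula; the factor 2 is positive because the flow follows -g.\<close>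

lemma sphere_gradient_flow_rank1_cost_iff:
  fixes A :: "real^'n^'m"
  shows "sphere_gradient_flow (rank1_cost A) u0 u \<longleftrightarrow>
    u 0 = u0 \<and> (\<forall>t\<ge>0. norm (u t) = 1 \<and>
      (u has_vector_derivative 2 *\<^sub>R (A ** transpose A *v u t -
        (u t \<bullet> (A ** transpose A *v u t)) *\<^sub>R u t)) (at t within {0..}))"
proof -
  let ?G = "\<lambda>x. - 2 *\<^sub>R (A ** transpose A *v x - (x \<bullet> (A ** transpose A *v x)) *\<^sub>R x)"
  have "has_sphere_gradient (rank1_cost A) x g \<longleftrightarrow> g = ?G x" if "x \<in> sphere 0 1" for x g
    using has_sphere_gradient_unique has_sphere_gradient_rank1_cost[OF that] by blast
  then show ?thesis
    unfolding sphere_gradient_flow_def by auto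
qed

theorem theorem1:
  fixes A :: "real^'n^'m" and U :: "(real^'m) measure"
  assumes "CARD('m) \<ge> 2 \<longrightarrow> singular_values A ! 0 > singular_values A ! 1"
    and "uniform_on_sphere U"
  shows "AE u0 in U.
    (\<exists>u. sphere_gradient_flow (rank1_cost A) u0 u) \<and>
    (\<forall>u. sphere_gradient_flow (rank1_cost A) u0 u \<longrightarrow>
      (\<exists>ustar. (u \<longlongrightarrow> ustar) at_top \<and>
        is_arg_min (rank1_cost A) (\<lambda>v. v \<in> sphere 0 1) ustar))"
proof -
  let ?M = "A ** transpose A"
  have "transpose ?M = ?M"
    by (simp add: matrix_transpose_mul)
  then obtain e d where ed: "orthonormal_eigenbasis ?M e d"
    by (rule symmetric_orthonormal_eigenbasis)
  interpret orthonormal_eigenbasis ?M e d by fact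
  obtain k where k: "\<And>j. j \<noteq> k \<Longrightarrow> d j < d k"
    using strict_dominant_eigenvalue[OF ed assms(1)] by blast
  have k_le: "d j \<le> d k" for j
    using k[of j] by (cases "j = k") auto
  have d_eq: "e i \<bullet> (?M *v e i) = d i" for i
    unfolding eigen by (simp add: orthonormal)
  \<comment> \<open>Each eigenvalue is the squared norm of \<open>transpose A *v e i\<close>; this
    supplies the sign of \<open>r\<close> in \<open>flow_coordinates\<close>.\<close>
  have nonneg: "0 \<le> d i" for i
    unfolding d_eq[of i, symmetric] inner_gram_matrix by simp
  have "e k \<noteq> 0"
    using orthonormal[of k k] by auto
  then have "AE u0 in U. u0 \<bullet> e k \<noteq> 0"
    by (rule uniform_on_sphere_AE_not_orthogonal[OF assms(2)])
  moreover have "AE u0 in U. norm u0 = 1"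
    by (rule AE_I2) (simp add: space_uniform_on_sphere[OF assms(2)])
  ultimately show ?thesis
  proof eventually_elim
    case (elim u0)
    show ?case
    proof (intro conjI allI impI)
      obtain u where "u 0 = u0" "\<And>t. norm (u t) = 1"
        "\<And>t. (u has_vector_derivative 2 *\<^sub>R (?M *v u t - (u t \<bullet> (?M *v u t)) *\<^sub>R u t)) (at t)"
        using flow_exists[OF elim(2)] by blast
      then show "\<exists>u. sphere_gradient_flow (rank1_cost A) u0 u"
        unfolding sphere_gradient_flow_rank1_cost_iff
        by (intro exI[of _ u]) (auto intro: has_vector_derivative_at_within)
    next
      fix u assume "sphere_gradient_flow (rank1_cost A) u0 u"
      then have u: "u 0 = u0" "\<And>t. 0 \<le> t \<Longrightarrow> norm (u t) = 1"
        "\<And>t. 0 \<le> t \<Longrightarrow> (u has_vector_derivative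
          2 *\<^sub>R (?M *v u t - (u t \<bullet> (?M *v u t)) *\<^sub>R u t)) (at t within {0..})"
        unfolding sphere_gradient_flow_rank1_cost_iff by auto
      \<comment> \<open>The initial point selects one of the two unit vectors \<plusminus> e k; both
        attain the maximum \<open>d k\<close> of the quadratic form.\<close>
      define ustar where "ustar = sgn (u0 \<bullet> e k) *\<^sub>R e k"
      have "(u \<longlongrightarrow> ustar) at_top"
        using flow_tendsto_dominant_eigenvector[OF nonneg k u(3,2)] elim(1)
        unfolding ustar_def u(1) by blast
      moreover have "is_arg_min (rank1_cost A) (\<lambda>v. v \<in> sphere 0 1) ustar"
      proof -
        have sgn: "sgn (u0 \<bullet> e k) * sgn (u0 \<bullet> e k) = 1"
          using elim(1) by (simp add: sgn_if)
        have unit: "norm ustar = 1"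
          using sgn by (simp add: ustar_def norm_eq_1 orthonormal)
        have "ustar \<bullet> (?M *v ustar) = d k"
          using sgn by (simp add: ustar_def linear_cmul[OF matrix_vector_mul_linear] d_eq
              flip: mult.assoc)
        then have "rank1_cost A ustar \<le> rank1_cost A v" if "norm v = 1" for v
          using quadratic_form_le_dominant[OF k_le that]
          by (simp add: rank1_cost_sphere that unit)
        with unit show ?thesis
          by (auto simp: is_arg_min_linorder)
      qed
      ultimately show "\<exists>ustar. (u \<longlongrightarrow> ustar) at_top \<and>
          is_arg_min (rank1_cost A) (\<lambda>v. v \<in> sphere 0 1) ustar"
        by blast
    qed
  qed
qed

end
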